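(* Let $T=\langle \mathbf{v}_A,\mathbf{v}_B,\mathbf{v}_C\rangle\subset\mathbb{R}^2$ be a nondegenerate triangle and let $f:T\to\mathbb{R}$ be a $C^3$ function that is a polynomial of degree at most $5$ on each of the 6 subtriangles of the (barycentric) Powell-Sabin 6-split of $T$. Write $\mathbf{t}:=\mathbf{v}_B-\mathbf{v}_A$ and $\mathbf{m}:=\frac12(\mathbf{v}_A+\mathbf{v}_B)-\mathbf{v}_C$. Then the value and derivatives of $f$ at the midpoint $\mathbf{v}_{AB}=(\mathbf{v}_A+\mathbf{v}_B)/2$ satisfy (subdivision rules) \begin{align*} f_{AB} &= \tfrac12 f_{A+B} + \tfrac{7}{40} f^{\mathbf{t}}_{A-B} + \tfrac{1}{40} f^{\mathbf{t}\mathbf{t}}_{A+B} + \tfrac{1}{640} f^{\mathbf{t}\mathbf{t}\mathbf{t}}_{A-B},\\ f^{\mathbf{t}}_{AB} &= -\tfrac52 f_{A-B} - \tfrac34 f^{\mathbf{t}}_{A+B} - \tfrac{3}{32} f^{\mathbf{t}\mathbf{t}}_{A-B} - \tfrac{1}{192} f^{\mathbf{t}\mathbf{t}\mathbf{t}}_{A+B},\\ f^{\mathbf{m}}_{AB} &= \tfrac12 f^{\mathbf{m}}_{A+B} + \tfrac{5}{32} f^{\mathbf{m}\mathbf{t}}_{A-B} + \tfrac{1}{64} f^{\mathbf{m}\mathbf{t}\mathbf{t}}_{A+B},\\ f^{\mathbf{t}\mathbf{t}}_{AB} &= -2 f^{\mathbf{t}}_{A-B} - \tfrac{1}{2} f^{\mathbf{t}\mathbf{t}}_{A+B}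 - \tfrac{1}{24} f^{\mathbf{t}\mathbf{t}\mathbf{t}}_{A-B},\\ f^{\mathbf{m}\mathbf{t}}_{AB} &= -2 f^{\mathbf{m}}_{A-B} - \tfrac{1}{2} f^{\mathbf{m}\mathbf{t}}_{A+B} - \tfrac{1}{24} f^{\mathbf{m}\mathbf{t}\mathbf{t}}_{A-B},\\ f^{\mathbf{m}\mathbf{m}}_{AB} &= \tfrac12 f^{\mathbf{m}\mathbf{m}}_{A+B} + \tfrac18 f^{\mathbf{t}\mathbf{m}\mathbf{m}}_{A-B},\\ f^{\mathbf{t}\mathbf{t}\mathbf{t}}_{AB} &= 120 f_{A-B} + 60 f^{\mathbf{t}}_{A+B} + \tfrac{21}{2} f^{\mathbf{t}\mathbf{t}}_{A-B} + \tfrac34 f^{\mathbf{t}\mathbf{t}\mathbf{t}}_{A+B},\\ f^{\mathbf{m}\mathbf{t}\mathbf{t}}_{AB} &= -\tfrac14 f^{\mathbf{m}\mathbf{t}\mathbf{t}}_{A+B} - \tfrac32 f^{\mathbf{m}\mathbf{t}}_{A-B},\\ f^{\mathbf{m}\mathbf{m}\mathbf{t}}_{AB} &= -\tfrac14 f^{\mathbf{m}\mathbf{m}\mathbf{t}}_{A+B} - \tfrac32 f^{\mathbf{m}\mathbf{m}}_{A-B},\\ f^{\mathbf{m}\mathbf{m}\mathbf{m}}_{AB} &= 45 f_{A+B} + 18 f^{\mathbf{t}}_{A-B} - 21 f^{\mathbf{m}}_{A+B} + \tfrac{45}{16} f^{\mathbf{t}\mathbf{t}}_{A+B} - \tfrac{63}{8}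 f^{\mathbf{t}\mathbf{m}}_{A-B}\\ &\quad + \tfrac{15}{4} f^{\mathbf{m}\mathbf{m}}_{A+B} + \tfrac{3}{16} f^{\mathbf{t}\mathbf{t}\mathbf{t}}_{A-B} - \tfrac78 f^{\mathbf{t}\mathbf{t}\mathbf{m}}_{A+B} + \tfrac54 f^{\mathbf{t}\mathbf{m}\mathbf{m}}_{A-B} + \tfrac14 f^{\mathbf{m}\mathbf{m}\mathbf{m}}_{A+B}\\ &\quad - 90 f_C - 48 f^{\mathbf{m}}_C + \tfrac98 f^{\mathbf{t}\mathbf{t}}_C - \tfrac{21}{2} f^{\mathbf{m}\mathbf{m}}_C + \tfrac14 f^{\mathbf{t}\mathbf{t}\mathbf{m}}_C - f^{\mathbf{m}\mathbf{m}\mathbf{m}}_C. \end{align*}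
   Context: 6-split (barycentric): insert in $T$ its barycenter $(\mathbf{v}_A+\mathbf{v}_B+\mathbf{v}_C)/3$ and the midpoints of the three edges, and connect the barycenter by line segments to the three vertices and the three midpoints. This divides $T$ into 6 subtriangles. Derivatives: $\nabla_{\mathbf{u}}f(\mathbf{v})=\frac{d}{dt}f(\mathbf{v}+t\mathbf{u})|_{t=0}$ (vectors not normalized; at boundary points of $T$, derivatives are those of the polynomial pieces, i.e. continuous extensions from the interior). A subscript $P$ denotes evaluation at the point $\mathbf{v}_P$, and superscripts denote directional derivatives: $f^{\mathbf{u}_1\cdots\mathbf{u}_k}_P=(\nabla_{\mathbf{u}_1}\cdots\nabla_{\mathbf{u}_k}f)(\mathbf{v}_P)$. Moreover $f^{\mathbf{u}_1\cdots\mathbf{u}_k}_{A\pm B}:=f^{\mathbf{u}_1\cdots\mathbf{u}_k}_A\pm f^{\mathbf{u}_1\cdots\mathbf{u}_k}_B$. *)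

theory Defs
  imports "HOL-Analysis.Analysis"
begin

definition dir_deriv :: "'a::real_normed_vector \<Rightarrow> ('a \<Rightarrow> real) \<Rightarrow> 'a \<Rightarrow> real" where
  "dir_deriv u f v = deriv (\<lambda>t. f (v + t *\<^sub>R u)) 0"

text \<open>\<open>iter_deriv [u\<^sub>1, \<dots>, u\<^sub>k] f\<close> is \<open>\<nabla>u\<^sub>1 \<dots> \<nabla>u\<^sub>k f\<close>; at an interior point of the domain it only
  depends on the germ of \<open>f\<close> there.\<close>

definition iter_deriv :: "'a::real_normed_vector list \<Rightarrow> ('a \<Rightarrow> real) \<Rightarrow> 'a \<Rightarrow> real" where
  "iter_deriv us f = foldr dir_deriv us f"

text \<open>\<open>C\<^sup>k\<close> functions on a set \<open>S\<close> contained in the closure of its interior: the derivatives up to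
  order \<open>k\<close> exist in the interior and extend continuously to \<open>S\<close>. Values of \<open>f\<close> outside \<open>S\<close> play no
  role. The case \<open>us = []\<close> of the extension clause alone would not constrain \<open>f\<close> on the boundary,
  hence the separate requirement \<open>continuous_on S f\<close>.\<close>

definition Ck_on :: "nat \<Rightarrow> ('a::real_normed_vector \<Rightarrow> real) \<Rightarrow> 'a set \<Rightarrow> bool" where
  "Ck_on k f S \<longleftrightarrow> continuous_on S f \<and>
     (\<forall>us. length us < k \<longrightarrow> iter_deriv us f differentiable_on interior S) \<and>
     (\<forall>us. length us \<le> k \<longrightarrow>
        (\<exists>g. continuous_on S g \<and> (\<forall>x\<in>interior S. g x = iter_deriv us f x)))"

text \<open>The derivative of \<open>f\<close> on \<open>S\<close>, boundary points included, as the continuous extension of the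
  derivative from the interior.\<close>

definition deriv_on :: "'a::real_normed_vector set \<Rightarrow> ('a \<Rightarrow> real) \<Rightarrow> 'a list \<Rightarrow> 'a \<Rightarrow> real" where
  "deriv_on S f us v = (if us = [] then f v else Lim (at v within interior S) (iter_deriv us f))"

definition barycentric_six_split :: "real^2 \<Rightarrow> real^2 \<Rightarrow> real^2 \<Rightarrow> (real^2) set set" where
  "barycentric_six_split A B C =
     (let G = (1/3) *\<^sub>R (A + B + C) in
       {convex hull {A, midpoint A B, G}, convex hull {B, midpoint A B, G},
        convex hull {B, midpoint B C, G}, convex hull {C, midpoint B C, G},
        convex hull {C, midpoint C A, G}, convex hull {A, midpoint C A, G}})"

definition polynomial_upto_on :: "nat \<Rightarrow> (real^2 \<Rightarrow> real) \<Rightarrow> (real^2) set \<Rightarrow> bool" where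
  "polynomial_upto_on d f S \<longleftrightarrow>
     (\<exists>c :: nat \<Rightarrow> nat \<Rightarrow> real. \<forall>v\<in>S. f v = (\<Sum>i\<le>d. \<Sum>j\<le>d - i. c i j * (v $ 1) ^ i * (v $ 2) ^ j))"

end

(* In the affine coordinates (x, y) with v = v_AB + x t + y m, every polynomial piece is given by
   21 coefficients, and A = (-1/2, 0), B = (1/2, 0), C = (0, -1), with barycenter (0, -1/3).
   Derivatives of order at most 3 at a boundary point of T or at a point of a common edge may be
   computed from any adjacent piece, since they extend continuously to T.

   The pieces adjacent to v_AB agree to order 3 along x = 0, so their coefficients of x^i y^j agree
   for i <= 3; all rules except the last are then linear identities between the remaining
   coefficients. The last rule also involves the derivatives at C. These enter through a functional
   that can be rewritten as a combination of derivatives of order at most 3 at points of the median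
   through A, and also at points of the median through B. Hence it takes the same value on all
   pieces met when going from C to v_AB around A, and the rule again reduces to an identity for the
   pieces at v_AB. *)
theory Submission
  imports Defs
begin

section \<open>Polynomials of bounded total degree and affine changes of coordinates\<close>

definition cross2 :: "real^2 \<Rightarrow> real^2 \<Rightarrow> real" where
  "cross2 u v = u $ 1 * v $ 2 - u $ 2 * v $ 1"

definition bivariate_eval :: "nat \<Rightarrow> (nat \<Rightarrow> nat \<Rightarrow> real) \<Rightarrow> real \<Rightarrow> real \<Rightarrow> real" where
  "bivariate_eval n c x y = (\<Sum>i\<le>n. \<Sum>j\<le>n. c i j * x ^ i * y ^ j)"

text \<open>\<open>bivariate_eval\<close> sums over a full square of exponents. This condition cuts
  the array down to a triangle and also makes all entries outside the square 0, so index shifts are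
  harmless.\<close>

definition total_degree_le :: "nat \<Rightarrow> (nat \<Rightarrow> nat \<Rightarrow> real) \<Rightarrow> bool" where
  "total_degree_le n c \<longleftrightarrow> (\<forall>i j. n < i + j \<longrightarrow> c i j = 0)"

text \<open>A coefficient-free description: closure under products and affine substitution then
  needs no convolution of arrays. \<open>bivariate_poly_coefficients\<close> returns to arrays
  afterwards.\<close>

inductive bivariate_poly :: "nat \<Rightarrow> (real \<Rightarrow> real \<Rightarrow> real) \<Rightarrow> bool" where
  monomial: "i + j \<le> n \<Longrightarrow> bivariate_poly n (\<lambda>x y. a * x ^ i * y ^ j)"
| add: "bivariate_poly n g \<Longrightarrow> bivariate_poly n h \<Longrightarrow> bivariate_poly n (\<lambda>x y. g x y + h x y)"

lemma bivariate_poly_const: "bivariate_poly n (\<lambda>x y. a)"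
  using bivariate_poly.monomial[of 0 0 n a] by simp

lemma bivariate_poly_sum:
  "finite I \<Longrightarrow> (\<And>i. i \<in> I \<Longrightarrow> bivariate_poly n (g i)) \<Longrightarrow> bivariate_poly n (\<lambda>x y. \<Sum>i\<in>I. g i x y)"
  by (induction I rule: finite_induct) (auto intro: bivariate_poly_const bivariate_poly.add)

lemma bivariate_poly_mono: "bivariate_poly n g \<Longrightarrow> n \<le> k \<Longrightarrow> bivariate_poly k g"
  by (induction rule: bivariate_poly.induct) (auto intro: bivariate_poly.intros)

lemma bivariate_poly_mult_monomial:
  "bivariate_poly n g \<Longrightarrow> bivariate_poly (n + (i + j)) (\<lambda>x y. g x y * (a * x ^ i * y ^ j))"
proof (induction rule: bivariate_poly.induct)
  case (monomial k l n b)
  have "bivariate_poly (n + (i + j)) (\<lambda>x y. (b * a) * x ^ (k + i) * y ^ (l + j))"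
    using monomial by (intro bivariate_poly.monomial) auto
  then show ?case by (simp add: power_add mult_ac)
next
  case (add n g h)
  then show ?case by (simp add: distrib_right bivariate_poly.add)
qed

lemma bivariate_poly_mult:
  assumes "bivariate_poly k h" "bivariate_poly n g"
  shows "bivariate_poly (n + k) (\<lambda>x y. g x y * h x y)"
  using assms
proof (induction rule: bivariate_poly.induct)
  case (monomial i j k a)
  show ?case
    by (rule bivariate_poly_mono[OF bivariate_poly_mult_monomial]) (use monomial in auto)
next
  case (add k h1 h2)
  then show ?case by (simp add: distrib_left bivariate_poly.add)
qed

lemma bivariate_poly_power:
  "bivariate_poly n g \<Longrightarrow> bivariate_poly (k * n) (\<lambda>x y. g x y ^ k)"
  by (induction k) (auto intro: bivariate_poly_const bivariate_poly_mult simp: add.commute mult.commute)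

lemma bivariate_poly_affine: "bivariate_poly 1 (\<lambda>x y. a + x * b + y * c)"
  using bivariate_poly.monomial[of 1 0 1 b] bivariate_poly.monomial[of 0 1 1 c]
  by (auto intro!: bivariate_poly.add bivariate_poly_const simp: mult.commute)

lemma bivariate_poly_coefficients:
  "bivariate_poly n g \<Longrightarrow> \<exists>c. total_degree_le n c \<and> g = bivariate_eval n c"
proof (induction rule: bivariate_poly.induct)
  case (monomial i j n a)
  \<comment> \<open>The nested conditionals follow the order of the two sums, so that the sums
    collapse one after the other.\<close>
  let ?c = "\<lambda>k l. if k = i then (if l = j then a else 0) else 0"
  have "bivariate_eval n ?c = (\<lambda>x y. a * x ^ i * y ^ j)"
  proof (intro ext)
    fix x y
    have "bivariate_eval n ?c x y
        = (\<Sum>k\<le>n. if k = i then (\<Sum>l\<le>n. if l = j then a * x ^ i * y ^ j else 0) else 0)"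
      unfolding bivariate_eval_def by (intro sum.cong refl) (auto intro!: sum.cong simp del: sum.delta)
    also have "\<dots> = a * x ^ i * y ^ j"
      using monomial by simp
    finally show "bivariate_eval n ?c x y = a * x ^ i * y ^ j" .
  qed
  then show ?case
    using monomial by (intro exI[of _ ?c]) (auto simp: total_degree_le_def)
next
  case (add n g h)
  then obtain c c' where "total_degree_le n c" "g = bivariate_eval n c"
    "total_degree_le n c'" "h = bivariate_eval n c'"
    by blast
  then show ?case
    by (intro exI[of _ "\<lambda>i j. c i j + c' i j"])
       (auto simp: total_degree_le_def bivariate_eval_def sum.distrib distrib_right)
qed

text \<open>Both components of the point have degree at most 1 in \<open>x\<close> and
  \<open>y\<close>, so substitution does not raise the total degree of a monomial.\<close>

lemma polynomial_upto_on_affine_coordinates: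
  assumes "polynomial_upto_on n f S"
  obtains c where "total_degree_le n c"
    "\<And>x y. M + x *\<^sub>R t + y *\<^sub>R m \<in> S \<Longrightarrow> f (M + x *\<^sub>R t + y *\<^sub>R m) = bivariate_eval n c x y"
proof -
  from assms obtain a where a: "\<And>v. v \<in> S \<Longrightarrow>
      f v = (\<Sum>i\<le>n. \<Sum>j\<le>n - i. a i j * (v $ 1) ^ i * (v $ 2) ^ j)"
    unfolding polynomial_upto_on_def by blast
  let ?L = "\<lambda>k x y. M $ k + x * t $ k + y * m $ k"
  have "bivariate_poly n (\<lambda>x y. \<Sum>i\<le>n. \<Sum>j\<le>n - i. a i j * ?L 1 x y ^ i * ?L 2 x y ^ j)"
  proof (intro bivariate_poly_sum finite_atMost)
    fix i j assume "i \<in> {..n}" "j \<in> {..n - i}"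
    then have "i + j \<le> n" by auto
    have "bivariate_poly (0 + i * 1 + j * 1) (\<lambda>x y. a i j * ?L 1 x y ^ i * ?L 2 x y ^ j)"
      by (intro bivariate_poly_mult bivariate_poly_power bivariate_poly_affine bivariate_poly_const)
    with \<open>i + j \<le> n\<close> show "bivariate_poly n (\<lambda>x y. a i j * ?L 1 x y ^ i * ?L 2 x y ^ j)"
      by (auto intro: bivariate_poly_mono)
  qed
  then obtain c where "total_degree_le n c"
    "(\<lambda>x y. \<Sum>i\<le>n. \<Sum>j\<le>n - i. a i j * ?L 1 x y ^ i * ?L 2 x y ^ j) = bivariate_eval n c"
    using bivariate_poly_coefficients by blast
  then show thesis
    using a by (intro that[of c]) (auto simp: fun_eq_iff)
qed

section \<open>Formal differentiation of coefficient arrays\<close>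

text \<open>The array of \<open>a\<close> times the x-derivative plus \<open>b\<close> times the
  y-derivative. The degree bound \<open>n\<close> is kept, not lowered, so that the operation can be
  iterated.\<close>

definition coeff_deriv :: "real \<Rightarrow> real \<Rightarrow> (nat \<Rightarrow> nat \<Rightarrow> real) \<Rightarrow> nat \<Rightarrow> nat \<Rightarrow> real" where
  "coeff_deriv a b c i j = a * (real (Suc i) * c (Suc i) j) + b * (real (Suc j) * c i (Suc j))"

lemma total_degree_le_coeff_deriv:
  "total_degree_le n c \<Longrightarrow> total_degree_le n (coeff_deriv a b c)"
  by (simp add: total_degree_le_def coeff_deriv_def)

lemma sum_deriv_shift:
  fixes a :: "nat \<Rightarrow> real"
  assumes "a (Suc n) = 0"
  shows "(\<Sum>i\<le>n. real i * a i * x ^ (i - 1)) = (\<Sum>i\<le>n. real (Suc i) * a (Suc i) * x ^ i)"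
proof -
  have "(\<Sum>i\<le>n. real i * a i * x ^ (i - 1)) = (\<Sum>i\<le>Suc n. real i * a i * x ^ (i - 1))"
    using assms by simp
  also have "\<dots> = (\<Sum>i\<le>n. real (Suc i) * a (Suc i) * x ^ i)"
    by (subst sum.atMost_Suc_shift) simp
  finally show ?thesis .
qed

text \<open>The right-hand side is what termwise differentiation produces; at exponent 0 the
  truncated \<open>i - 1\<close> is harmless because of the factor \<open>real i\<close>.\<close>

lemma bivariate_eval_coeff_deriv:
  assumes "total_degree_le n c"
  shows "bivariate_eval n (coeff_deriv a b c) x y =
    (\<Sum>i\<le>n. \<Sum>j\<le>n. c i j * (a * (real i * x ^ (i - 1)) * y ^ j + b * x ^ i * (real j * y ^ (j - 1))))"
proof -
  have c: "c (Suc n) j = 0" "c j (Suc n) = 0" for j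
    using assms by (auto simp: total_degree_le_def)
  have "(\<Sum>i\<le>n. \<Sum>j\<le>n. c i j * (a * (real i * x ^ (i - 1)) * y ^ j + b * x ^ i * (real j * y ^ (j - 1))))
    = (\<Sum>j\<le>n. a * y ^ j * (\<Sum>i\<le>n. real i * c i j * x ^ (i - 1)))
      + (\<Sum>i\<le>n. b * x ^ i * (\<Sum>j\<le>n. real j * c i j * y ^ (j - 1)))"
    unfolding sum_distrib_left
    by (subst (2) sum.swap) (simp add: sum.distrib[symmetric] algebra_simps)
  also have "\<dots> = (\<Sum>j\<le>n. a * y ^ j * (\<Sum>i\<le>n. real (Suc i) * c (Suc i) j * x ^ i))
      + (\<Sum>i\<le>n. b * x ^ i * (\<Sum>j\<le>n. real (Suc j) * c i (Suc j) * y ^ j))"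
    using c by (simp only: sum_deriv_shift)
  also have "\<dots> = bivariate_eval n (coeff_deriv a b c) x y"
    unfolding sum_distrib_left bivariate_eval_def
    by (subst (1) sum.swap) (simp add: sum.distrib[symmetric] algebra_simps coeff_deriv_def)
  finally show ?thesis by simp
qed

lemma has_real_derivative_bivariate_eval:
  assumes "total_degree_le n c"
  shows "((\<lambda>s. bivariate_eval n c (x + s * a) (y + s * b))
    has_real_derivative bivariate_eval n (coeff_deriv a b c) x y) (at 0)"
  unfolding bivariate_eval_coeff_deriv[OF assms] unfolding bivariate_eval_def
  by (rule DERIV_sum | (auto intro!: derivative_eq_intros simp: algebra_simps)[1])+

text \<open>Cramer's rule: if \<open>cross2 t m \<noteq> 0\<close>, the two quotients are the
  coordinates of \<open>v - M\<close> in the basis \<open>t\<close>, \<open>m\<close>. This extends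
  a polynomial piece to the whole plane.\<close>

definition affine_poly ::
    "nat \<Rightarrow> (nat \<Rightarrow> nat \<Rightarrow> real) \<Rightarrow> real^2 \<Rightarrow> real^2 \<Rightarrow> real^2 \<Rightarrow> real^2 \<Rightarrow> real" where
  "affine_poly n c M t m v =
    bivariate_eval n c (cross2 (v - M) m / cross2 t m) (cross2 t (v - M) / cross2 t m)"

definition coeff_dir_deriv ::
    "real^2 \<Rightarrow> real^2 \<Rightarrow> real^2 \<Rightarrow> (nat \<Rightarrow> nat \<Rightarrow> real) \<Rightarrow> nat \<Rightarrow> nat \<Rightarrow> real" where
  "coeff_dir_deriv t m u = coeff_deriv (cross2 u m / cross2 t m) (cross2 t u / cross2 t m)"

text \<open>Moving along \<open>u\<close> changes the two coordinates at constant rates, namely the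
  quotients used in \<open>coeff_dir_deriv\<close>.\<close>

lemma dir_deriv_affine_poly:
  assumes "total_degree_le n c"
  shows "dir_deriv u (affine_poly n c M t m) = affine_poly n (coeff_dir_deriv t m u c) M t m"
proof
  fix v
  have "cross2 (v + s *\<^sub>R u - M) m / cross2 t m
      = cross2 (v - M) m / cross2 t m + s * (cross2 u m / cross2 t m)"
    "cross2 t (v + s *\<^sub>R u - M) / cross2 t m
      = cross2 t (v - M) / cross2 t m + s * (cross2 t u / cross2 t m)" for s
    by (simp_all add: cross2_def field_simps flip: add_divide_distrib diff_divide_distrib)
  then show "dir_deriv u (affine_poly n c M t m) v = affine_poly n (coeff_dir_deriv t m u c) M t m v"
    unfolding dir_deriv_def affine_poly_def coeff_dir_deriv_def
    using has_real_derivative_bivariate_eval[OF assms]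
    by (simp add: DERIV_imp_deriv del: times_divide_eq_right)
qed

lemma iter_deriv_affine_poly:
  assumes "total_degree_le n c"
  shows "iter_deriv us (affine_poly n c M t m) = affine_poly n (foldr (coeff_dir_deriv t m) us c) M t m"
proof -
  have "total_degree_le n (foldr (coeff_dir_deriv t m) us c)
      \<and> foldr dir_deriv us (affine_poly n c M t m) = affine_poly n (foldr (coeff_dir_deriv t m) us c) M t m"
    using assms
    by (induction us)
       (auto simp: dir_deriv_affine_poly coeff_dir_deriv_def total_degree_le_coeff_deriv)
  then show ?thesis by (simp add: iter_deriv_def)
qed

lemma continuous_on_affine_poly: "continuous_on S (affine_poly n c M t m)"
  unfolding affine_poly_def bivariate_eval_def cross2_def divide_inverse
  by (intro continuous_intros)

lemma affine_poly_at:
  assumes "cross2 t m \<noteq> 0"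
  shows "affine_poly n c M t m (M + x *\<^sub>R t + y *\<^sub>R m) = bivariate_eval n c x y"
proof -
  have "cross2 (x *\<^sub>R t + y *\<^sub>R m) m = x * cross2 t m" "cross2 t (x *\<^sub>R t + y *\<^sub>R m) = y * cross2 t m"
    by (simp_all add: cross2_def algebra_simps)
  with assms show ?thesis by (simp add: affine_poly_def add.assoc)
qed

lemma affine_coordinates:
  assumes "cross2 t m \<noteq> 0"
  obtains x y where "v = M + x *\<^sub>R t + y *\<^sub>R m"
proof
  show "v = M + (cross2 (v - M) m / cross2 t m) *\<^sub>R t + (cross2 t (v - M) / cross2 t m) *\<^sub>R m"
    unfolding vec_eq_iff forall_2 using assms
    by (simp add: field_simps) (simp add: cross2_def algebra_simps)
qed

section \<open>Boundary derivatives computed from a single piece\<close>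

lemma iter_deriv_cong_open:
  assumes "open U" "\<And>v. v \<in> U \<Longrightarrow> f v = g v" "v \<in> U"
  shows "iter_deriv us f v = iter_deriv us g v"
proof -
  have "\<forall>v\<in>U. foldr dir_deriv us f v = foldr dir_deriv us g v"
  proof (induction us)
    case (Cons u us)
    show ?case
    proof
      fix v assume "v \<in> U"
      have "(\<lambda>s. v + s *\<^sub>R u) \<midarrow>0\<rightarrow> v"
        by (auto intro!: tendsto_eq_intros)
      then have "eventually (\<lambda>s. v + s *\<^sub>R u \<in> U) (at 0)"
        using \<open>open U\<close> \<open>v \<in> U\<close> by (rule topological_tendstoD)
      \<comment> \<open>\<open>deriv_cong_ev\<close> requires equality on a full neighbourhood,
        including the parameter 0 itself.\<close>
      with \<open>v \<in> U\<close> have "eventually (\<lambda>s. v + s *\<^sub>R u \<in> U) (nhds 0)"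
        by (simp add: eventually_nhds_conv_at)
      then have "eventually (\<lambda>s. foldr dir_deriv us f (v + s *\<^sub>R u)
          = foldr dir_deriv us g (v + s *\<^sub>R u)) (nhds 0)"
        by eventually_elim (use Cons in simp)
      then show "foldr dir_deriv (u # us) f v = foldr dir_deriv (u # us) g v"
        by (simp add: dir_deriv_def[of u] deriv_cong_ev)
    qed
  qed (use assms in simp)
  then show ?thesis
    using \<open>v \<in> U\<close> by (simp add: iter_deriv_def)
qed

text \<open>The continuous extension \<open>h\<close> gives the limit through the interior of
  \<open>T\<close>. Approaching \<open>x\<close> only through the interior of \<open>S\<close>,
  where \<open>f\<close> and \<open>g\<close> have equal derivatives, identifies this limit.\<close>

lemma deriv_on_eq_iter_deriv_piece:
  fixes f g :: "'a::euclidean_space \<Rightarrow> real"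
  assumes "Ck_on k f T" "length us \<le> k" "S \<subseteq> T" "convex S" "interior S \<noteq> {}" "x \<in> S"
    and fg: "\<And>v. v \<in> S \<Longrightarrow> f v = g v"
    and cont: "continuous_on UNIV (iter_deriv us g)"
  shows "deriv_on T f us x = iter_deriv us g x"
proof (cases "us = []")
  case True
  then show ?thesis using assms by (simp add: deriv_on_def iter_deriv_def)
next
  case False
  obtain h where h: "continuous_on T h" "\<And>v. v \<in> interior T \<Longrightarrow> h v = iter_deriv us f v"
    using assms(1,2) unfolding Ck_on_def by metis
  have sub: "interior S \<subseteq> interior T"
    by (rule interior_mono) fact
  \<comment> \<open>A convex set with nonempty interior lies in the closure of its interior. Hence
    both filters below are nontrivial and limits along them are unique.\<close>
  have "x \<in> closure (interior S)"
    using assms convex_closure_interior closure_subset by blast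
  then have "x islimpt interior S"
    by (metis closure_def Un_iff mem_Collect_eq interior_limit_point interior_interior)
  then have nS: "at x within interior S \<noteq> bot" and nT: "at x within interior T \<noteq> bot"
    using sub by (auto simp: trivial_limit_within islimpt_subset)
  have "(h \<longlongrightarrow> h x) (at x within interior T)"
    using h(1) assms interior_subset by (meson continuous_on_def subsetD tendsto_within_subset)
  then have lim: "(iter_deriv us f \<longlongrightarrow> h x) (at x within interior T)"
    by (rule Lim_transform_eventually) (auto simp: eventually_at_filter h(2))
  then have "(iter_deriv us f \<longlongrightarrow> h x) (at x within interior S)"
    using sub by (rule tendsto_within_subset)
  then have "(iter_deriv us g \<longlongrightarrow> h x) (at x within interior S)"
  proof (rule Lim_transform_eventually)
    have "iter_deriv us f v = iter_deriv us g v" if "v \<in> interior S" for v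
      by (rule iter_deriv_cong_open[OF open_interior _ that]) (use fg interior_subset in blast)
    then show "eventually (\<lambda>v. iter_deriv us f v = iter_deriv us g v) (at x within interior S)"
      by (simp add: eventually_at_filter)
  qed
  moreover have "(iter_deriv us g \<longlongrightarrow> iter_deriv us g x) (at x within interior S)"
    using cont by (meson UNIV_I continuous_on_def subset_UNIV tendsto_within_subset)
  ultimately have "h x = iter_deriv us g x"
    using nS tendsto_unique by blast
  then show ?thesis
    using False lim nT by (simp add: deriv_on_def tendsto_Lim)
qed

section \<open>Nondegenerate triangles\<close>

lemma collinear_iff_cross2: "collinear {a, b, c} \<longleftrightarrow> cross2 (b - a) (c - a) = 0"
proof
  assume "collinear {a, b, c}"
  then obtain u x y where "b - a = y *\<^sub>R u" "c - a = x *\<^sub>R u"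
    unfolding collinear_def by auto
  then show "cross2 (b - a) (c - a) = 0" by (simp add: cross2_def)
next
  assume 0: "cross2 (b - a) (c - a) = 0"
  show "collinear {a, b, c}"
  proof (cases "b = a")
    case False
    \<comment> \<open>The coefficient of the orthogonal projection of \<open>c - a\<close> onto
      \<open>b - a\<close>.\<close>
    define s where "s = (c - a) \<bullet> (b - a) / ((b - a) \<bullet> (b - a))"
    have pos: "(b$1 - a$1) * (b$1 - a$1) + (b$2 - a$2) * (b$2 - a$2) \<noteq> 0"
      using False by (simp add: sum_squares_eq_zero_iff vec_eq_iff forall_2)
    have "(c$k - a$k) * ((b$1 - a$1) * (b$1 - a$1) + (b$2 - a$2) * (b$2 - a$2))
        = ((c$1 - a$1) * (b$1 - a$1) + (c$2 - a$2) * (b$2 - a$2)) * (b$k - a$k)" for k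
    proof (cases "k = 1")
      case True
      show ?thesis
        using 0 unfolding True cross2_def vector_minus_component by algebra
    next
      case False
      then have "k = 2" using exhaust_2 by blast
      show ?thesis
        using 0 unfolding \<open>k = 2\<close> cross2_def vector_minus_component by algebra
    qed
    then have "c - a = s *\<^sub>R (b - a)"
      using pos unfolding vec_eq_iff forall_2 s_def inner_vec_def sum_2
      by (simp add: nonzero_eq_divide_eq)
    then have "c = (1 - s) *\<^sub>R a + (1 - (1 - s)) *\<^sub>R b"
      by (simp add: algebra_simps)
    then show ?thesis
      unfolding insert_commute[of b c] collinear_3_expand[of a c b] by blast
  qed simp
qed

text \<open>The centroid has three positive barycentric weights, which characterizes interior points
  of a noncollinear triangle.\<close>

lemma interior_triangle_nonempty:
  fixes a b c :: "real^2"
  assumes "cross2 (b - a) (c - a) \<noteq> 0"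
  shows "interior (convex hull {a, b, c}) \<noteq> {}"
proof -
  have "\<not> collinear {a, b, c}"
    using assms by (simp add: collinear_iff_cross2)
  moreover have "(1/3) *\<^sub>R a + (1/3) *\<^sub>R b + (1/3) *\<^sub>R c = (1/3) *\<^sub>R (a + b + c)"
    by (simp add: scaleR_add_right)
  ultimately have "(1/3) *\<^sub>R (a + b + c) \<in> interior (convex hull {a, b, c})"
    by (subst interior_convex_hull_3_minimal) (auto intro!: exI[of _ "1/3"])
  then show ?thesis by blast
qed

section \<open>Mixed partial derivatives in affine coordinates\<close>

definition mixed_deriv :: "nat \<Rightarrow> nat \<Rightarrow> (nat \<Rightarrow> nat \<Rightarrow> real) \<Rightarrow> real \<Rightarrow> real \<Rightarrow> real" where
  "mixed_deriv a b c = bivariate_eval 5 ((coeff_deriv 1 0 ^^ a) ((coeff_deriv 0 1 ^^ b) c))"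

lemma coeff_deriv_commute: "coeff_deriv 0 1 (coeff_deriv 1 0 c) = coeff_deriv 1 0 (coeff_deriv 0 1 c)"
  by (simp add: fun_eq_iff coeff_deriv_def)

lemma coeff_deriv_funpow_commute:
  "coeff_deriv 0 1 ((coeff_deriv 1 0 ^^ a) c) = (coeff_deriv 1 0 ^^ a) (coeff_deriv 0 1 c)"
  by (induction a) (simp_all add: coeff_deriv_commute)

text \<open>In the basis \<open>t\<close>, \<open>m\<close> these directions are the coordinate
  directions. The two coefficient derivatives commute, so only multiplicities in the list
  matter.\<close>

lemma foldr_coeff_dir_deriv:
  assumes "cross2 t m \<noteq> 0" "set us \<subseteq> {t, m}"
  shows "foldr (coeff_dir_deriv t m) us c
    = (coeff_deriv 1 0 ^^ count_list us t) ((coeff_deriv 0 1 ^^ count_list us m) c)"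
proof -
  have 0: "cross2 u u = 0" for u
    by (simp add: cross2_def)
  have "t \<noteq> m"
    using assms(1) 0 by auto
  moreover have "coeff_dir_deriv t m t = coeff_deriv 1 0" "coeff_dir_deriv t m m = coeff_deriv 0 1"
    using assms(1) by (simp_all add: coeff_dir_deriv_def 0)
  ultimately show ?thesis
    using assms(2) by (induction us) (auto simp: coeff_deriv_funpow_commute)
qed

lemma funpow_coeff_deriv:
  "(coeff_deriv 1 0 ^^ a) ((coeff_deriv 0 1 ^^ b) c) i j
    = fact (i + a) / fact i * (fact (j + b) / fact j) * c (i + a) (j + b)"
proof -
  have y: "(coeff_deriv 0 1 ^^ b) c i j = fact (j + b) / fact j * c i (j + b)" for i j
    by (induction b arbitrary: j) (simp_all add: coeff_deriv_def)
  have "(coeff_deriv 1 0 ^^ a) c' i j = fact (i + a) / fact i * c' (i + a) j" for c'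
    by (induction a arbitrary: i) (simp_all add: coeff_deriv_def)
  then show ?thesis
    by (simp add: y mult_ac)
qed

lemma mixed_deriv_expand:
  "mixed_deriv a b c x y =
    (\<Sum>i\<le>5. \<Sum>j\<le>5.
       fact (i + a) / fact i * (fact (j + b) / fact j) * c (i + a) (j + b) * x ^ i * y ^ j)"
  by (simp add: mixed_deriv_def bivariate_eval_def funpow_coeff_deriv)

section \<open>The functional at \<open>C\<close> and its transport across the medians\<close>

text \<open>Collects the terms of the last rule that are evaluated at \<open>C\<close>, whose affine
  coordinates are (0, -1).\<close>

definition corner_functional :: "(nat \<Rightarrow> nat \<Rightarrow> real) \<Rightarrow> real" where
  "corner_functional c = 9/8 * mixed_deriv 2 0 c 0 (-1) - 90 * mixed_deriv 0 0 c 0 (-1)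
    - 48 * mixed_deriv 0 1 c 0 (-1) - 21/2 * mixed_deriv 0 2 c 0 (-1)
    + 1/4 * mixed_deriv 2 1 c 0 (-1) - mixed_deriv 0 3 c 0 (-1)"

text \<open>The evaluation points lie on the medians \<open>2x + 3y + 1 = 0\<close> through \<open>A\<close> and
  \<open>3y - 2x + 1 = 0\<close> through \<open>B\<close>. Such combinations exist because the functional vanishes on all
  multiples of the fourth power of either linear form; the coefficients solve a linear system.\<close>

lemma corner_functional_median_A:
  assumes "total_degree_le 5 c"
  shows "corner_functional c =
    - 90 * mixed_deriv 0 0 c 0 (-1/3) + 12 * mixed_deriv 0 1 c 0 (-1/3)
    - 1/2 * mixed_deriv 0 2 c 0 (-1/3) + 9/8 * mixed_deriv 2 0 c 0 (-1/3)
    + 2/3 * mixed_deriv 1 2 c 0 (-1/3) - 1/2 * mixed_deriv 2 1 c 0 (-1/3)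
    + 2 * mixed_deriv 0 2 c (-1/2) 0 + 1/3 * mixed_deriv 1 2 c (-1/2) 0
    - 8/9 * mixed_deriv 0 3 c (-1/4) (-1/6)"
proof -
  have z: "c i j = 0" if "5 < i + j" for i j
    using assms that by (simp add: total_degree_le_def)
  show ?thesis
    \<comment> \<open>Both sides are linear in the 21 entries with \<open>i + j \<le> 5\<close>;
      full expansion leaves a comparison of coefficients.\<close>
    unfolding corner_functional_def mixed_deriv_expand
    by (simp add: fact_numeral atMost_Suc eval_nat_numeral z) (simp add: field_simps)
qed

lemma corner_functional_median_B:
  assumes "total_degree_le 5 c"
  shows "corner_functional c =
    - 90 * mixed_deriv 0 0 c 0 (-1/3) + 12 * mixed_deriv 0 1 c 0 (-1/3)
    - 13/2 * mixed_deriv 0 2 c 0 (-1/3) + 9/8 * mixed_deriv 2 0 c 0 (-1/3)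
    - 2/3 * mixed_deriv 0 3 c 0 (-1/3)
    + 4/3 * mixed_deriv 1 2 c 0 (-1/3) - 1/2 * mixed_deriv 2 1 c 0 (-1/3)
    + 8 * mixed_deriv 0 2 c (-1/4) (-1/2) + 2/3 * mixed_deriv 1 2 c (-1/4) (-1/2)
    + 16/9 * mixed_deriv 0 3 c (-1/8) (-5/12)"
proof -
  have z: "c i j = 0" if "5 < i + j" for i j
    using assms that by (simp add: total_degree_le_def)
  show ?thesis
    unfolding corner_functional_def mixed_deriv_expand
    by (simp add: fact_numeral atMost_Suc eval_nat_numeral z) (simp add: field_simps)
qed

section \<open>Gluing adjacent pieces and the resulting linear identities\<close>

text \<open>On \<open>x = 0\<close> the x-derivative of order \<open>i\<close> is a polynomial in
  \<open>y\<close> of degree at most \<open>5 - i\<close>, determined by its derivatives of order up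
  to \<open>3 - i\<close> at three points. For \<open>i = 3\<close> these are three values of a
  quadratic.\<close>

lemma coefficients_eq_if_join_at_y_axis:
  assumes c: "total_degree_le 5 c" and e: "total_degree_le 5 e"
    and join: "\<And>a b y. a + b \<le> 3 \<Longrightarrow> y \<in> {0, -1/6, -1/3} \<Longrightarrow>
      mixed_deriv a b c 0 y = mixed_deriv a b e 0 y"
    and "i \<le> 3"
  shows "e i j = c i j"
proof -
  define d where "d i j = c i j - e i j" for i j
  have z: "d i j = 0" if "5 < i + j" for i j
    using c e that by (simp add: total_degree_le_def d_def)
  have "mixed_deriv a b d x y = mixed_deriv a b c x y - mixed_deriv a b e x y" for a b x y
    unfolding mixed_deriv_expand d_def sum_subtractf[symmetric] by (simp only: left_diff_distrib right_diff_distrib)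
  then have J: "mixed_deriv a b d 0 0 = 0 \<and> mixed_deriv a b d 0 (-1/6) = 0 \<and> mixed_deriv a b d 0 (-1/3) = 0"
    if "a + b \<le> 3" for a b
    using join that by simp
  note simps = mixed_deriv_expand fact_numeral atMost_Suc eval_nat_numeral z
  \<comment> \<open>Derivatives at the origin isolate single coefficients. Each row
    \<open>i \<le> 3\<close> then has two unknowns left, settled by the data at -1/6 and
    -1/3.\<close>
  have 0: "d 0 0 = 0" "d 0 1 = 0" "d 0 2 = 0" "d 0 3 = 0" "d 1 0 = 0" "d 1 1 = 0" "d 1 2 = 0"
    "d 2 0 = 0" "d 2 1 = 0" "d 3 0 = 0"
    using J[of 0 0] J[of 0 1] J[of 0 2] J[of 0 3] J[of 1 0] J[of 1 1] J[of 1 2] J[of 2 0] J[of 2 1]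
      J[of 3 0] by (simp_all add: simps)
  have 1: "d 0 4 = 0 \<and> d 0 5 = 0"
    using J[of 0 0] J[of 0 1] 0 by (simp add: simps)
  have 2: "d 1 3 = 0 \<and> d 1 4 = 0"
    using J[of 1 0] J[of 1 1] 0 by (simp add: simps)
  have 3: "d 2 2 = 0 \<and> d 2 3 = 0"
    using J[of 2 0] 0 by (simp add: simps)
  have 4: "d 3 1 = 0 \<and> d 3 2 = 0"
    using J[of 3 0] 0 by (simp add: simps)
  have "d i j = 0"
  proof (cases "i + j \<le> 5")
    case True
    then have "j \<in> {0,1,2,3,4,5}" "i \<in> {0,1,2,3}" using \<open>i \<le> 3\<close> by auto
    with True show ?thesis using 0 1 2 3 4 by auto
  qed (simp add: z)
  then show ?thesis by (simp add: d_def)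
qed

text \<open>One array serves all points of \<open>S\<close>, boundary included, which lets adjacent
  pieces be compared at common points.\<close>

lemma piece_derivatives:
  fixes T S :: "(real^2) set"
  assumes "Ck_on k f T" "polynomial_upto_on 5 f S" "S \<subseteq> T" "convex S" "interior S \<noteq> {}"
    and nz: "cross2 t m \<noteq> 0"
  obtains c where "total_degree_le 5 c"
    "\<And>us x y. length us \<le> k \<Longrightarrow> set us \<subseteq> {t, m} \<Longrightarrow> M + x *\<^sub>R t + y *\<^sub>R m \<in> S \<Longrightarrow>
      deriv_on T f us (M + x *\<^sub>R t + y *\<^sub>R m) = mixed_deriv (count_list us t) (count_list us m) c x y"
proof -
  obtain c where c: "total_degree_le 5 c"
    "\<And>x y. M + x *\<^sub>R t + y *\<^sub>R m \<in> S \<Longrightarrow> f (M + x *\<^sub>R t + y *\<^sub>R m) = bivariate_eval 5 c x y"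
    using polynomial_upto_on_affine_coordinates[OF assms(2)] by metis
  have f: "f v = affine_poly 5 c M t m v" if "v \<in> S" for v
    using affine_coordinates[OF nz, of v M] c(2) that affine_poly_at[OF nz] by metis
  show thesis
  proof (rule that[OF c(1)])
    fix us x y
    assume "length us \<le> k" and us: "set us \<subseteq> {t, m}" and "M + x *\<^sub>R t + y *\<^sub>R m \<in> S"
    then have "deriv_on T f us (M + x *\<^sub>R t + y *\<^sub>R m)
        = iter_deriv us (affine_poly 5 c M t m) (M + x *\<^sub>R t + y *\<^sub>R m)"
      using assms f
      by (intro deriv_on_eq_iter_deriv_piece[of k f T us S])
         (auto simp: iter_deriv_affine_poly[OF c(1)] continuous_on_affine_poly)
    then show "deriv_on T f us (M + x *\<^sub>R t + y *\<^sub>R m)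
        = mixed_deriv (count_list us t) (count_list us m) c x y"
      by (simp add: iter_deriv_affine_poly[OF c(1)] affine_poly_at[OF nz] mixed_deriv_def
          foldr_coeff_dir_deriv[OF nz us])
  qed
qed

text \<open>After \<open>join\<close>, each rule is a linear identity in the entries of
  \<open>a\<close> and those entries of \<open>b\<close> with \<open>i > 3\<close>. For the piece at
  \<open>A\<close> and the edge midpoint, \<open>corner_functional a\<close> evaluates the
  polynomial at \<open>C\<close>, outside that piece.\<close>

lemma subdivision_rules:
  assumes a: "total_degree_le 5 a" and b: "total_degree_le 5 b"
    and join: "\<And>i j. i \<le> 3 \<Longrightarrow> b i j = a i j"
  defines "D \<equiv> \<lambda>i j. mixed_deriv i j a 0 0"
    and "p \<equiv> \<lambda>i j. mixed_deriv i j a (-1/2) 0 + mixed_deriv i j b (1/2) 0"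
    and "q \<equiv> \<lambda>i j. mixed_deriv i j a (-1/2) 0 - mixed_deriv i j b (1/2) 0"
  shows
    "D 0 0 = 1/2 * p 0 0 + 7/40 * q 1 0 + 1/40 * p 2 0 + 1/640 * q 3 0"
    "D 1 0 = - 5/2 * q 0 0 - 3/4 * p 1 0 - 3/32 * q 2 0 - 1/192 * p 3 0"
    "D 0 1 = 1/2 * p 0 1 + 5/32 * q 1 1 + 1/64 * p 2 1"
    "D 2 0 = - 2 * q 1 0 - 1/2 * p 2 0 - 1/24 * q 3 0"
    "D 1 1 = - 2 * q 0 1 - 1/2 * p 1 1 - 1/24 * q 2 1"
    "D 0 2 = 1/2 * p 0 2 + 1/8 * q 1 2"
    "D 3 0 = 120 * q 0 0 + 60 * p 1 0 + 21/2 * q 2 0 + 3/4 * p 3 0"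
    "D 2 1 = - 1/4 * p 2 1 - 3/2 * q 1 1"
    "D 1 2 = - 1/4 * p 1 2 - 3/2 * q 0 2"
    "D 0 3 = 45 * p 0 0 + 18 * q 1 0 - 21 * p 0 1 + 45/16 * p 2 0 - 63/8 * q 1 1
      + 15/4 * p 0 2 + 3/16 * q 3 0 - 7/8 * p 2 1 + 5/4 * q 1 2 + 1/4 * p 0 3
      + corner_functional a"
proof -
  have z: "a i j = 0" "b i j = 0" if "5 < i + j" for i j
    using a b that by (simp_all add: total_degree_le_def)
  note simps = D_def p_def q_def corner_functional_def mixed_deriv_expand
    fact_numeral atMost_Suc eval_nat_numeral z join
  show
    "D 0 0 = 1/2 * p 0 0 + 7/40 * q 1 0 + 1/40 * p 2 0 + 1/640 * q 3 0"
    "D 1 0 = - 5/2 * q 0 0 - 3/4 * p 1 0 - 3/32 * q 2 0 - 1/192 * p 3 0"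
    "D 0 1 = 1/2 * p 0 1 + 5/32 * q 1 1 + 1/64 * p 2 1"
    "D 2 0 = - 2 * q 1 0 - 1/2 * p 2 0 - 1/24 * q 3 0"
    "D 1 1 = - 2 * q 0 1 - 1/2 * p 1 1 - 1/24 * q 2 1"
    "D 0 2 = 1/2 * p 0 2 + 1/8 * q 1 2"
    "D 3 0 = 120 * q 0 0 + 60 * p 1 0 + 21/2 * q 2 0 + 3/4 * p 3 0"
    "D 2 1 = - 1/4 * p 2 1 - 3/2 * q 1 1"
    "D 1 2 = - 1/4 * p 1 2 - 3/2 * q 0 2"
    "D 0 3 = 45 * p 0 0 + 18 * q 1 0 - 21 * p 0 1 + 45/16 * p 2 0 - 63/8 * q 1 1
      + 15/4 * p 0 2 + 3/16 * q 3 0 - 7/8 * p 2 1 + 5/4 * q 1 2 + 1/4 * p 0 3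
      + corner_functional a"
    by (simp_all add: simps field_simps)
qed

section \<open>Passage through the pieces around the barycenter\<close>

theorem mainTheorem3:
  fixes A B C t m :: "real^2" and T :: "(real^2) set" and f :: "real^2 \<Rightarrow> real"
    and D p q :: "(real^2) list \<Rightarrow> real" and d :: "(real^2) list \<Rightarrow> real^2 \<Rightarrow> real"
  assumes nondegenerate: "\<not> collinear {A, B, C}"
    and T_def: "T = convex hull {A, B, C}"
    and smooth: "Ck_on 3 f T"
    and piecewise: "\<forall>S\<in>barycentric_six_split A B C. polynomial_upto_on 5 f S"
    and t_def: "t = B - A"
    and m_def: "m = (1/2) *\<^sub>R (A + B) - C"
    and d_def: "d = deriv_on T f"
    and D_def: "D = (\<lambda>us. d us (midpoint A B))"
    and p_def: "p = (\<lambda>us. d us A + d us B)"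
    and q_def: "q = (\<lambda>us. d us A - d us B)"
  shows
    "D [] = 1/2 * p [] + 7/40 * q [t] + 1/40 * p [t,t] + 1/640 * q [t,t,t] \<and>
     D [t] = - 5/2 * q [] - 3/4 * p [t] - 3/32 * q [t,t] - 1/192 * p [t,t,t] \<and>
     D [m] = 1/2 * p [m] + 5/32 * q [m,t] + 1/64 * p [m,t,t] \<and>
     D [t,t] = - 2 * q [t] - 1/2 * p [t,t] - 1/24 * q [t,t,t] \<and>
     D [m,t] = - 2 * q [m] - 1/2 * p [m,t] - 1/24 * q [m,t,t] \<and>
     D [m,m] = 1/2 * p [m,m] + 1/8 * q [t,m,m] \<and>
     D [t,t,t] = 120 * q [] + 60 * p [t] + 21/2 * q [t,t] + 3/4 * p [t,t,t] \<and>
     D [m,t,t] = - 1/4 * p [m,t,t] - 3/2 * q [m,t] \<and>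
     D [m,m,t] = - 1/4 * p [m,m,t] - 3/2 * q [m,m] \<and>
     D [m,m,m] =
       45 * p [] + 18 * q [t] - 21 * p [m] + 45/16 * p [t,t] - 63/8 * q [t,m]
       + 15/4 * p [m,m] + 3/16 * q [t,t,t] - 7/8 * p [t,t,m] + 5/4 * q [t,m,m] + 1/4 * p [m,m,m]
       - 90 * d [] C - 48 * d [m] C + 9/8 * d [t,t] C - 21/2 * d [m,m] C
       + 1/4 * d [t,t,m] C - d [m,m,m] C"
proof -
  define v where "v x y = midpoint A B + x *\<^sub>R t + y *\<^sub>R m" for x y
  have vertices: "v 0 0 = midpoint A B" "v (-1/2) 0 = A" "v (1/2) 0 = B" "v 0 (-1) = C"
    "v 0 (-1/3) = (1/3) *\<^sub>R (A + B + C)" "v (-1/4) (-1/2) = midpoint C A"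
    unfolding v_def t_def m_def midpoint_def vec_eq_iff forall_2 by (auto simp: field_simps)
  have cross: "cross2 (B - A) (C - A) \<noteq> 0"
    using nondegenerate by (simp add: collinear_iff_cross2)
  \<comment> \<open>Since \<open>m = (A - C) + (1/2) *\<^sub>R t\<close>, this determinant is minus
    the previous one.\<close>
  then have nz: "cross2 t m \<noteq> 0" 
    unfolding t_def m_def cross2_def by (auto simp: field_simps)
  then have tm: "t \<noteq> m"
    by (auto simp: cross2_def)
  have hull: "convex T" "A \<in> T" "B \<in> T" "C \<in> T"
    by (auto simp: T_def hull_inc)
  then have mid: "midpoint A B \<in> T" "midpoint C A \<in> T"
    by (meson closed_segment_subset midpoint_in_closed_segment subsetD)+
  have "(1/3) *\<^sub>R A + (1/3) *\<^sub>R B + (1/3) *\<^sub>R C \<in> T"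
    unfolding T_def convex_hull_3 by (intro CollectI exI[of _ "1/3"]) auto
  then have bary: "v 0 (-1/3) \<in> T"
    unfolding vertices scaleR_add_right .
  define S where "S P Q = convex hull {P, Q, v 0 (-1/3)}" for P Q
  have derivs: "\<exists>c. total_degree_le 5 c \<and> (\<forall>us x y. length us \<le> 3 \<longrightarrow> set us \<subseteq> {t, m} \<longrightarrow> v x y \<in> S P Q \<longrightarrow>
      d us (v x y) = mixed_deriv (count_list us t) (count_list us m) c x y)"
    if "S P Q \<in> barycentric_six_split A B C" "P \<in> T" "Q \<in> T" "cross2 (Q - P) (v 0 (-1/3) - P) \<noteq> 0" for P Q
  proof -
    have "S P Q \<subseteq> T"
      unfolding S_def using that hull bary by (intro hull_minimal) auto
    moreover have "interior (S P Q) \<noteq> {}"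
      unfolding S_def using that(4) by (rule interior_triangle_nonempty)
    moreover have "convex (S P Q)"
      by (simp add: S_def)
    moreover have "polynomial_upto_on 5 f (S P Q)"
      using piecewise that(1) by blast
    ultimately obtain c where "total_degree_le 5 c"
      "\<And>us x y. length us \<le> 3 \<Longrightarrow> set us \<subseteq> {t, m} \<Longrightarrow> v x y \<in> S P Q \<Longrightarrow>
        d us (v x y) = mixed_deriv (count_list us t) (count_list us m) c x y"
      using piece_derivatives[OF smooth _ _ _ _ nz, where M = "midpoint A B", folded v_def d_def]
      by blast
    then show ?thesis
      by blast
  qed
  \<comment> \<open>The pieces met on the way from \<open>B\<close> past \<open>A\<close> to
    \<open>C\<close> around the barycenter.\<close>
  have split: "S A (midpoint A B) \<in> barycentric_six_split A B C"
    "S B (midpoint A B) \<in> barycentric_six_split A B C"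
    "S A (midpoint C A) \<in> barycentric_six_split A B C"
    "S C (midpoint C A) \<in> barycentric_six_split A B C"
    unfolding barycentric_six_split_def Let_def S_def vertices by simp_all
  have nondeg: "cross2 (midpoint A B - A) (v 0 (-1/3) - A) \<noteq> 0"
    "cross2 (midpoint A B - B) (v 0 (-1/3) - B) \<noteq> 0"
    "cross2 (midpoint C A - A) (v 0 (-1/3) - A) \<noteq> 0"
    "cross2 (midpoint C A - C) (v 0 (-1/3) - C) \<noteq> 0"
    using cross unfolding vertices by (auto simp: cross2_def midpoint_def field_simps)
  obtain a where a: "total_degree_le 5 a" "\<And>us x y. length us \<le> 3 \<Longrightarrow> set us \<subseteq> {t, m} \<Longrightarrow>
      v x y \<in> S A (midpoint A B) \<Longrightarrow> d us (v x y) = mixed_deriv (count_list us t) (count_list us m) a x y"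
    using derivs[OF split(1) hull(2) mid(1) nondeg(1)] by blast
  obtain b where b: "total_degree_le 5 b" "\<And>us x y. length us \<le> 3 \<Longrightarrow> set us \<subseteq> {t, m} \<Longrightarrow>
      v x y \<in> S B (midpoint A B) \<Longrightarrow> d us (v x y) = mixed_deriv (count_list us t) (count_list us m) b x y"
    using derivs[OF split(2) hull(3) mid(1) nondeg(2)] by blast
  obtain a' where a': "total_degree_le 5 a'" "\<And>us x y. length us \<le> 3 \<Longrightarrow> set us \<subseteq> {t, m} \<Longrightarrow>
      v x y \<in> S A (midpoint C A) \<Longrightarrow> d us (v x y) = mixed_deriv (count_list us t) (count_list us m) a' x y"
    using derivs[OF split(3) hull(2) mid(2) nondeg(3)] by blast
  obtain c where c: "total_degree_le 5 c" "\<And>us x y. length us \<le> 3 \<Longrightarrow> set us \<subseteq> {t, m} \<Longrightarrow>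
      v x y \<in> S C (midpoint C A) \<Longrightarrow> d us (v x y) = mixed_deriv (count_list us t) (count_list us m) c x y"
    using derivs[OF split(4) hull(4) mid(2) nondeg(4)] by blast
  have in_S: "P \<in> S P Q" "Q \<in> S P Q" "v 0 (-1/3) \<in> S P Q" "midpoint P (v 0 (-1/3)) \<in> S P Q"
    "midpoint Q (v 0 (-1/3)) \<in> S P Q" for P Q
  proof -
    show *: "P \<in> S P Q" "Q \<in> S P Q" "v 0 (-1/3) \<in> S P Q"
      by (simp_all add: S_def hull_inc)
    have "convex (S P Q)"
      by (simp add: S_def)
    with * show "midpoint P (v 0 (-1/3)) \<in> S P Q" "midpoint Q (v 0 (-1/3)) \<in> S P Q"
      by (meson closed_segment_subset midpoint_in_closed_segment subsetD)+
  qed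
  \<comment> \<open>Midpoints of the three crossed edges; they supply the remaining sample points of
    the gluing lemma and of the two median formulas.\<close>
  have edge_midpoints: "midpoint (midpoint A B) (v 0 (-1/3)) = v 0 (-1/6)"
    "midpoint A (v 0 (-1/3)) = v (-1/4) (-1/6)"
    "midpoint (midpoint C A) (v 0 (-1/3)) = v (-1/8) (-5/12)"
    unfolding vertices unfolding v_def t_def m_def midpoint_def vec_eq_iff forall_2
    by (auto simp: field_simps)
  have edge_A: "v x y \<in> S A (midpoint A B) \<and> v x y \<in> S A (midpoint C A)"
    if "(x, y) \<in> {(-1/2, 0), (-1/4, -1/6), (0, -1/3)}" for x y
    using that in_S(1,3,4)[of A, unfolded edge_midpoints] vertices(2) by force
  have edge_B: "v x y \<in> S A (midpoint C A) \<and> v x y \<in> S C (midpoint C A)"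
    if "(x, y) \<in> {(-1/4, -1/2), (-1/8, -5/12), (0, -1/3)}" for x y
    using that in_S(2,3,5)[where Q = "midpoint C A", unfolded edge_midpoints] vertices(6) by force
  have edge_C: "v 0 y \<in> S A (midpoint A B) \<and> v 0 y \<in> S B (midpoint A B)"
    if "y \<in> {0, -1/6, -1/3}" for y
    using that in_S(2,3,5)[where Q = "midpoint A B", unfolded edge_midpoints] vertices(1) by force
  \<comment> \<open>\<open>d\<close> refers to \<open>T\<close> and not to a piece, so two arrays
    valid at a common point give the same derivatives there.\<close>
  have join: "mixed_deriv i j p x y = mixed_deriv i j q x y"
    if "i + j \<le> 3" "v x y \<in> P" "v x y \<in> Q"
      "\<And>us x y. length us \<le> 3 \<Longrightarrow> set us \<subseteq> {t, m} \<Longrightarrow>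
        v x y \<in> P \<Longrightarrow> d us (v x y) = mixed_deriv (count_list us t) (count_list us m) p x y"
      "\<And>us x y. length us \<le> 3 \<Longrightarrow> set us \<subseteq> {t, m} \<Longrightarrow>
        v x y \<in> Q \<Longrightarrow> d us (v x y) = mixed_deriv (count_list us t) (count_list us m) q x y"
    for i j x y p q P Q
  proof -
    have us: "length (replicate i t @ replicate j m) \<le> 3" "set (replicate i t @ replicate j m) \<subseteq> {t, m}"
      using that(1) by auto
    have cnt: "count_list (replicate k u) w = (if u = w then k else 0)" for k and u w :: "real^2"
      by (induction k) auto
    have "count_list (replicate i t @ replicate j m) t = i" "count_list (replicate i t @ replicate j m) m = j"
      using tm by (simp_all add: cnt)
    then show ?thesis
      using that(4)[OF us that(2)] that(5)[OF us that(3)] by simp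
  qed
  have ba: "b i j = a i j" if "i \<le> 3" for i j
    using join[OF _ _ _ a(2) b(2)] edge_C that
    by (intro coefficients_eq_if_join_at_y_axis[OF a(1) b(1)]) blast+
  have joinA: "mixed_deriv i j a x y = mixed_deriv i j a' x y"
    if "i + j \<le> 3" "(x, y) \<in> {(-1/2, 0), (-1/4, -1/6), (0, -1/3)}" for i j x y
    using join[OF that(1) _ _ a(2) a'(2)] edge_A[OF that(2)] by blast
  have joinB: "mixed_deriv i j a' x y = mixed_deriv i j c x y"
    if "i + j \<le> 3" "(x, y) \<in> {(-1/4, -1/2), (-1/8, -5/12), (0, -1/3)}" for i j x y
    using join[OF that(1) _ _ a'(2) c(2)] edge_B[OF that(2)] by blast
  \<comment> \<open>First the edge on the median through \<open>B\<close> is crossed, then the edge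
    on the median through \<open>A\<close>.\<close>
  have "corner_functional c = corner_functional a'"
    unfolding corner_functional_median_B[OF c(1)] corner_functional_median_B[OF a'(1)]
    by (simp add: joinB)
  also have "\<dots> = corner_functional a"
    unfolding corner_functional_median_A[OF a(1)] corner_functional_median_A[OF a'(1)]
    by (simp add: joinA)
  finally have corner: "corner_functional c = corner_functional a" .
  have dA: "d us A = mixed_deriv (count_list us t) (count_list us m) a (-1/2) 0"
    and dM: "d us (midpoint A B) = mixed_deriv (count_list us t) (count_list us m) a 0 0"
    and dB: "d us B = mixed_deriv (count_list us t) (count_list us m) b (1/2) 0"
    and dC: "d us C = mixed_deriv (count_list us t) (count_list us m) c 0 (-1)"
    if "length us \<le> 3" "set us \<subseteq> {t, m}" for us
    using a(2)[OF that, of "-1/2" 0, unfolded vertices] a(2)[OF that, of 0 0, unfolded vertices]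
      b(2)[OF that, of "1/2" 0, unfolded vertices] c(2)[OF that, of 0 "-1", unfolded vertices]
      in_S(1,2) by blast+
  note rules = subdivision_rules[OF a(1) b(1) ba] corner[unfolded corner_functional_def]
  show ?thesis
    unfolding D_def p_def q_def
    \<comment> \<open>Derivative orders are put into successor form, the form in which
      \<open>count_list\<close> and \<open>size\<close> evaluate on explicit lists.\<close>
    using rules[unfolded numeral_2_eq_2 numeral_3_eq_3 One_nat_def] tm
    by (intro conjI) (simp_all only: dA dM dB dC list.size count_list.simps set_simps
      insert_subset insertI1 insertI2 empty_subsetI simp_thms if_True if_False
      add_0_left add_0_right Suc_le_mono le0 add_Suc_right tm[symmetric]
      One_nat_def numeral_2_eq_2 numeral_3_eq_3 Suc_eq_plus1[symmetric] corner_functional_def)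
qed

end
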